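(* Assume the continuum hypothesis. Then the following hold. (i) Every ideal is the union of an increasing chain of countably generated ideals. (ii) An ideal $I$ is the union of an increasing chain of principal ideals if for every countably generated ideal $J\subset I$ there is a principal ideal $L$ with $J\subset L\subset I$.
   Context: $H$ is a separable infinite-dimensional complex Hilbert space. "Ideal" means a nonzero two-sided ideal of $B(H)$ contained in the compact operators. A principal ideal is one generated by a single operator; a countably generated ideal is one generated by a countable set of operators. An increasing chain of ideals is a (possibly uncountable) family of ideals totally ordered by inclusion. *)

theory Defs
  imports "HOL-Analysis.Analysis" "HOL-Algebra.Ideal" "HOL-Library.Equipollence"
begin

(* The norm and the topology come from the class banach; the last axiom makes the norm the one
   induced by the inner product, and thereby also yields positive definiteness of cinner.
   The inner product is linear in the first argument. *)
class complex_hilbert_space = banach +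
  fixes scaleC :: "complex \<Rightarrow> 'a \<Rightarrow> 'a"
    and cinner :: "'a \<Rightarrow> 'a \<Rightarrow> complex"
  assumes scaleC_add_right: "scaleC a (x + y) = scaleC a x + scaleC a y"
    and scaleC_add_left: "scaleC (a + b) x = scaleC a x + scaleC b x"
    and scaleC_scaleC: "scaleC a (scaleC b x) = scaleC (a * b) x"
    and scaleC_of_real: "scaleC (complex_of_real r) x = scaleR r x"
    and cinner_add_left: "cinner (x + y) z = cinner x z + cinner y z"
    and cinner_scaleC_left: "cinner (scaleC a x) y = a * cinner x y"
    and cinner_commute: "cinner x y = cnj (cinner y x)"
    and cinner_self: "cinner x x = complex_of_real ((norm x)\<^sup>2)"

lemma vector_space_scaleC:
  "vector_space (scaleC :: complex \<Rightarrow> 'a \<Rightarrow> 'a::complex_hilbert_space)"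
proof
  show "scaleC 1 x = x" for x :: 'a
    using scaleC_of_real[of 1 x] by simp
qed (simp_all add: scaleC_add_right scaleC_add_left scaleC_scaleC)

definition infinite_dimensional :: "'h::complex_hilbert_space itself \<Rightarrow> bool" where
  "infinite_dimensional _ \<longleftrightarrow>
     \<not> (\<exists>B. finite B \<and> module.span scaleC B = (UNIV :: 'h set))"

definition bounded_operators :: "('h::complex_hilbert_space \<Rightarrow> 'h) ring" where
  "bounded_operators =
     \<lparr>carrier = {T. bounded_linear T \<and> (\<forall>c x. T (scaleC c x) = scaleC c (T x))},
      monoid.mult = (\<circ>), one = id, zero = (\<lambda>x. 0), add = (\<lambda>S T x. S x + T x)\<rparr>"

lemma ring_bounded_operators:
  "ring (bounded_operators :: ('h::complex_hilbert_space \<Rightarrow> 'h) ring)"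
proof -
  have scaleC_zero: "scaleC c (0 :: 'h) = 0" for c
    using scaleC_add_right[of c "0 :: 'h" 0] by simp
  have scaleC_minus: "scaleC c (- x) = - scaleC c x" for c and x :: 'h
    using scaleC_add_right[of c x "- x"] by (simp add: scaleC_zero minus_unique)
  show ?thesis
  proof (intro ringI abelian_groupI monoidI)
    fix S assume "S \<in> carrier (bounded_operators :: ('h \<Rightarrow> 'h) ring)"
    then show "\<exists>T\<in>carrier bounded_operators.
        T \<oplus>\<^bsub>bounded_operators\<^esub> S = \<zero>\<^bsub>bounded_operators\<^esub>"
      by (intro bexI[of _ "\<lambda>x. - S x"])
        (auto simp: bounded_operators_def bounded_linear_minus scaleC_minus)
  qed (auto simp: bounded_operators_def o_def fun_eq_iff id_def scaleC_zero scaleC_add_right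
      algebra_simps bounded_linear_add bounded_linear_compose bounded_linear_zero
      bounded_linear_ident linear_add bounded_linear.linear)
qed

definition compact_operators :: "('h::complex_hilbert_space \<Rightarrow> 'h) set" where
  "compact_operators = {T \<in> carrier bounded_operators. compact (closure (T ` cball 0 1))}"

definition operator_ideal :: "('h::complex_hilbert_space \<Rightarrow> 'h) set \<Rightarrow> bool" where
  "operator_ideal I \<longleftrightarrow>
     ideal I bounded_operators \<and> I \<noteq> {\<zero>\<^bsub>bounded_operators\<^esub>} \<and> I \<subseteq> compact_operators"

definition principal_operator_ideal :: "('h::complex_hilbert_space \<Rightarrow> 'h) set \<Rightarrow> bool" where
  "principal_operator_ideal I \<longleftrightarrow> operator_ideal I \<and> principalideal I bounded_operators"

definition countably_generated_operator_ideal ::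
    "('h::complex_hilbert_space \<Rightarrow> 'h) set \<Rightarrow> bool" where
  "countably_generated_operator_ideal I \<longleftrightarrow> operator_ideal I \<and>
     (\<exists>S \<subseteq> carrier bounded_operators. countable S \<and> I = Idl\<^bsub>bounded_operators\<^esub> S)"

definition continuum_hypothesis :: bool where
  "continuum_hypothesis \<longleftrightarrow> (\<forall>A :: real set. countable A \<or> A \<approx> (UNIV :: real set))"

end

theory Submission
  imports Defs
begin

text \<open>An operator on a separable space is determined by its values on a countable dense set, so
  an ideal has at most continuum many elements. Under CH it therefore carries a well-order all of
  whose proper initial segments are countable. Recursion along this order chooses for each element
  a member of the given class of subideals (countably generated or principal) that contains this
  element and everything chosen before; at each stage only countably many subideals have to be
  absorbed.\<close>

text \<open>Continuity makes a function recoverable from its values on a countable dense set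
  \<open>D\<close>, and each value is recoverable from the small balls around points of a countable
  dense set \<open>E\<close> that contain it. So a function is coded by a subset of a countable
  set.\<close>

lemma continuous_functions_lepoll_nat_sets:
  assumes "separable_space (euclidean :: 'a::topological_space topology)"
    and "separable_space (euclidean :: 'b::metric_space topology)"
  shows "{f :: 'a \<Rightarrow> 'b. continuous_on UNIV f} \<lesssim> (UNIV :: nat set set)"
proof -
  obtain D :: "'a set" where D: "countable D" "closure D = UNIV"
    using assms(1) by (auto simp: separable_space_def)
  obtain E :: "'b set" where E: "countable E" "closure E = UNIV"
    using assms(2) by (auto simp: separable_space_def)
  define N where "N = D \<times> E \<times> (UNIV :: nat set)"
  define code where "code f = {(d, e, n). d \<in> D \<and> e \<in> E \<and> dist (f d) e < inverse (Suc n)}"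
    for f :: "'a \<Rightarrow> 'b"
  have "inj_on code {f. continuous_on UNIV f}"
  proof (rule inj_onI, clarsimp)
    fix f g :: "'a \<Rightarrow> 'b"
    assume f: "continuous_on UNIV f" and g: "continuous_on UNIV g" and eq: "code f = code g"
    have "f d = g d" if d: "d \<in> D" for d
    proof (rule ccontr)
      assume "f d \<noteq> g d"
      \<comment> \<open>With a radius below half the distance, no point can be that close to both
        \<open>f d\<close> and \<open>g d\<close>; density of \<open>E\<close> and equality of the
        codes will nevertheless produce one.\<close>
      then obtain n where n: "inverse (real (Suc n)) < dist (f d) (g d) / 2"
        using reals_Archimedean[of "dist (f d) (g d) / 2"] by auto
      have "f d \<in> closure E"
        using E by simp
      moreover have "0 < inverse (real (Suc n))"
        by simp
      ultimately obtain e where e: "e \<in> E" "dist e (f d) < inverse (real (Suc n))"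
        unfolding closure_approachable by blast
      then have "(d, e, n) \<in> code f"
        using d by (simp add: code_def dist_commute)
      then have "dist (g d) e < inverse (real (Suc n))"
        unfolding eq by (simp add: code_def)
      then show False
        using n e(2) dist_triangle[of "f d" "g d" e] by (simp add: dist_commute)
    qed
    \<comment> \<open>Agreement on \<open>D\<close> extends to the closure of \<open>D\<close>
      because the set of agreement is closed.\<close>
    moreover have "closed {x. f x = g x}"
      using f g by (rule closed_Collect_eq)
    ultimately have "closure D \<subseteq> {x. f x = g x}"
      by (intro closure_minimal) auto
    then show "f = g"
      using D by auto
  qed
  then have "{f :: 'a \<Rightarrow> 'b. continuous_on UNIV f} \<lesssim> Pow N"
    unfolding lepoll_def by (intro exI[of _ code]) (auto simp: code_def N_def)
  also have "countable N"
    using D E by (simp add: N_def)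
  then have "inj_on ((`) (to_nat_on N)) (Pow N)"
    by (intro inj_on_image_Pow inj_on_to_nat_on)
  then have "Pow N \<lesssim> (UNIV :: nat set set)"
    unfolding lepoll_def by (intro exI[of _ "(`) (to_nat_on N)"]) auto
  finally show ?thesis .
qed

text \<open>\<open>card_of A\<close> is a well-order of least possible length on \<open>A\<close>,
  so a proper initial segment has strictly smaller cardinality than \<open>A\<close>. Under CH an
  uncountable one, embedded into the reals, would have the size of the continuum and so be at least
  as large as \<open>A\<close>.\<close>

lemma countable_underS_card_of:
  assumes "continuum_hypothesis" and "A \<lesssim> (UNIV :: real set)" and "a \<in> A"
  shows "countable (underS (card_of A) a)"
proof (rule ccontr)
  let ?U = "underS (card_of A) a"
  assume U: "uncountable ?U"
  have less: "ordLess2 (card_of ?U) (card_of A)"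
    using card_of_Card_order by (rule card_of_underS) (simp add: Field_card_of assms(3))
  have "?U \<subseteq> A"
    using underS_Field[of _ "card_of A" a] by (auto simp: Field_card_of)
  then obtain f :: "'a \<Rightarrow> real" where f: "inj_on f ?U"
    using assms(2) unfolding lepoll_def by (meson inj_on_subset)
  then have "uncountable (f ` ?U)"
    using U countable_image_inj_on by blast
  then have "f ` ?U \<approx> (UNIV :: real set)"
    using assms(1) by (auto simp: continuum_hypothesis_def)
  then have "A \<lesssim> f ` ?U"
    using assms(2) eqpoll_sym lepoll_trans2 by blast
  also have "f ` ?U \<approx> ?U"
    using f inj_on_image_eqpoll_self by blast
  finally have "ordLeq3 (card_of A) (card_of ?U)"
    by (simp add: lepoll_def flip: card_of_ordLeq)
  then show False
    using less not_ordLess_ordLeq by blast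
qed

text \<open>Phrased for families of sets so that both claims of the theorem are instances:
  \<open>\<F>\<close> will consist of the countably generated, respectively principal, ideals inside
  \<open>A\<close>. The set \<open>D\<close> in \<open>directed\<close> may be empty, which is the
  case that arises at the least element of the well-order.\<close>

lemma chain_union_if_countably_directed:
  assumes "continuum_hypothesis" and "A \<lesssim> (UNIV :: real set)" and "\<F> \<subseteq> Pow A"
    and directed: "\<And>D a. \<lbrakk>countable D; D \<subseteq> \<F>; a \<in> A\<rbrakk> \<Longrightarrow> \<exists>L\<in>\<F>. a \<in> L \<and> \<Union>D \<subseteq> L"
  shows "\<exists>\<C>\<subseteq>\<F>. chain\<^sub>\<subseteq> \<C> \<and> A = \<Union>\<C>"
proof -
  let ?r = "card_of A"
  let ?R = "?r - Id"
  \<comment> \<open>The set \<open>M\<close> chosen at \<open>a\<close> must contain everything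
    chosen strictly earlier. Outside \<open>A\<close> the condition is void, so \<open>L\<close> can
    be a total function. The condition reads \<open>L\<close> only strictly below \<open>a\<close>,
    as \<open>dependent_wf_choice\<close> requires.\<close>
  let ?P = "\<lambda>L a M. a \<in> A \<longrightarrow> M \<in> \<F> \<and> a \<in> M \<and> (\<forall>b. (b, a) \<in> ?R \<longrightarrow> L b \<subseteq> M)"
  have r: "well_order_on A ?r"
    by (rule card_of_well_order_on)
  have "\<exists>L. \<forall>a. ?P L a (L a)"
  proof (rule dependent_wf_choice[where R = ?R and P = ?P])
    show "wf ?R"
      using r by (simp add: well_order_on_def)
  next
    fix L a
    assume IH: "\<And>b. (b, a) \<in> ?R \<Longrightarrow> ?P L b (L b)"
    show "\<exists>M. ?P L a M"
    proof (cases "a \<in> A")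
      case True
      have "countable (underS ?r a)"
        using assms(1,2) True by (rule countable_underS_card_of)
      moreover have "L ` underS ?r a \<subseteq> \<F>"
      proof clarify
        fix b assume b: "b \<in> underS ?r a"
        then have "b \<in> A"
          using underS_Field[of b ?r a] by (simp add: Field_card_of)
        then show "L b \<in> \<F>"
          using IH[of b] b by (auto simp: underS_def)
      qed
      ultimately obtain M where "M \<in> \<F>" "a \<in> M" "\<Union> (L ` underS ?r a) \<subseteq> M"
        using directed[of "L ` underS ?r a" a] True by auto
      then show ?thesis
        by (intro exI[of _ M]) (auto simp: underS_def)
    qed simp
  qed simp
  then obtain L where L: "\<And>a. a \<in> A \<Longrightarrow> L a \<in> \<F> \<and> a \<in> L a \<and> (\<forall>b. (b, a) \<in> ?R \<longrightarrow> L b \<subseteq> L a)"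
    by blast
  have "chain\<^sub>\<subseteq> (L ` A)"
    unfolding chain_subset_def
  proof (intro ballI)
    fix X Y
    assume "X \<in> L ` A" "Y \<in> L ` A"
    then obtain a b where ab: "a \<in> A" "b \<in> A" "X = L a" "Y = L b"
      by blast
    have "total_on A ?r"
      using r by (simp add: well_order_on_def linear_order_on_def)
    then have "a = b \<or> (a, b) \<in> ?R \<or> (b, a) \<in> ?R"
      using ab by (auto simp: total_on_def)
    then show "X \<subseteq> Y \<or> Y \<subseteq> X"
      using L ab by blast
  qed
  moreover have "L ` A \<subseteq> \<F>" "A = \<Union> (L ` A)"
    using L assms(3) by blast+
  ultimately show ?thesis
    by blast
qed

text \<open>Members of an ideal are bounded, hence continuous, so it suffices to count the
  continuous self-maps of a separable space.\<close>

lemma operator_ideal_lepoll_reals: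
  assumes "separable_space (euclidean :: 'h::complex_hilbert_space topology)"
    and "operator_ideal (I :: ('h \<Rightarrow> 'h) set)"
  shows "I \<lesssim> (UNIV :: real set)"
proof -
  have "I \<subseteq> {f. continuous_on UNIV f}"
    using assms(2)
    by (auto simp: operator_ideal_def compact_operators_def bounded_operators_def
        intro: linear_continuous_on)
  then have "I \<lesssim> {f :: 'h \<Rightarrow> 'h. continuous_on UNIV f}"
    by (rule subset_imp_lepoll)
  also have "{f :: 'h \<Rightarrow> 'h. continuous_on UNIV f} \<lesssim> (UNIV :: nat set set)"
    using assms(1) assms(1) by (rule continuous_functions_lepoll_nat_sets)
  also have "(UNIV :: nat set set) \<approx> (UNIV :: real set)"
    by (rule nat_sets_eqpoll_reals)
  finally show ?thesis .
qed

text \<open>Serves the second claim, where a countable family of principal ideals is first absorbed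
  as a family of countably generated ones.\<close>

lemma principal_imp_countably_generated:
  assumes "principal_operator_ideal I"
  shows "countably_generated_operator_ideal I"
proof -
  obtain T where "T \<in> carrier bounded_operators" "I = Idl\<^bsub>bounded_operators\<^esub> {T}"
    using assms principalideal.generate unfolding principal_operator_ideal_def by blast
  then show ?thesis
    using assms unfolding principal_operator_ideal_def countably_generated_operator_ideal_def
    by (auto intro!: exI[of _ "{T}"])
qed

text \<open>Countably many countable generating sets have a countable union, and adding
  \<open>T\<close> keeps it countable. The ideal generated by it stays inside \<open>I\<close>
  because all the generators lie there.\<close>

lemma countably_generated_operator_ideals_directed:
  fixes I :: "('h::complex_hilbert_space \<Rightarrow> 'h) set"
  assumes I: "operator_ideal I" and "countable D" and "T \<in> I"
    and D: "\<And>J. J \<in> D \<Longrightarrow> countably_generated_operator_ideal J \<and> J \<subseteq> I"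
  shows "\<exists>L. countably_generated_operator_ideal L \<and> L \<subseteq> I \<and> T \<in> L \<and> \<Union>D \<subseteq> L"
proof -
  let ?B = "bounded_operators :: ('h \<Rightarrow> 'h) ring"
  interpret ring ?B
    by (rule ring_bounded_operators)
  have idI: "ideal I ?B" and cI: "I \<subseteq> compact_operators" and "I \<noteq> {\<zero>\<^bsub>?B\<^esub>}"
    using I by (simp_all add: operator_ideal_def)
  \<comment> \<open>\<open>X\<close> will join the generators to keep \<open>L\<close> from being
    the zero ideal, which could otherwise happen when \<open>T\<close> is zero and \<open>D\<close>
    is empty.\<close>
  then obtain X where X: "X \<in> I" "X \<noteq> \<zero>\<^bsub>?B\<^esub>"
    using \<open>T \<in> I\<close> by blast
  have carr: "I \<subseteq> carrier ?B"
    using ideal.Icarr[OF idI] by blast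
  have "\<forall>J\<in>D. \<exists>S\<subseteq>carrier ?B. countable S \<and> J = Idl\<^bsub>?B\<^esub> S"
    using D by (simp add: countably_generated_operator_ideal_def)
  then obtain S where S: "\<And>J. J \<in> D \<Longrightarrow> S J \<subseteq> carrier ?B \<and> countable (S J) \<and> J = Idl\<^bsub>?B\<^esub> (S J)"
    by metis
  define G where "G = insert T (insert X (\<Union>J\<in>D. S J))"
  define L where "L = Idl\<^bsub>?B\<^esub> G"
  have "S J \<subseteq> I" if "J \<in> D" for J
    using S[OF that] D[OF that] genideal_self[of "S J"] by blast
  then have GI: "G \<subseteq> I"
    using \<open>T \<in> I\<close> X(1) by (auto simp: G_def)
  then have G: "G \<subseteq> carrier ?B"
    using carr by blast
  have idL: "ideal L ?B" and GL: "G \<subseteq> L"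
    unfolding L_def using G by (rule genideal_ideal, rule genideal_self)
  have LI: "L \<subseteq> I"
    unfolding L_def using idI GI by (rule genideal_minimal)
  have DL: "J \<subseteq> L" if "J \<in> D" for J
  proof -
    have "S J \<subseteq> L"
      using GL that by (auto simp: G_def)
    then show ?thesis
      using S[OF that] genideal_minimal[OF idL] by blast
  qed
  have "operator_ideal L"
    using idL LI cI GL X(2) by (auto simp: operator_ideal_def G_def)
  moreover have "countable G"
    using \<open>countable D\<close> S by (auto simp: G_def)
  ultimately have "countably_generated_operator_ideal L"
    using G by (auto simp: countably_generated_operator_ideal_def L_def)
  then show ?thesis
    using LI GL DL by (intro exI[of _ L]) (auto simp: G_def)
qed

theorem proposition4p4:
  assumes "continuum_hypothesis"
    and "separable_space (euclidean :: 'h::complex_hilbert_space topology)"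
    and "infinite_dimensional TYPE('h)"
  shows "(\<forall>I :: ('h \<Rightarrow> 'h) set. operator_ideal I \<longrightarrow>
           (\<exists>\<C>. chain\<^sub>\<subseteq> \<C> \<and> (\<forall>J\<in>\<C>. countably_generated_operator_ideal J) \<and> I = \<Union>\<C>)) \<and>
         (\<forall>I :: ('h \<Rightarrow> 'h) set. operator_ideal I \<longrightarrow>
           (\<forall>J. countably_generated_operator_ideal J \<and> J \<subseteq> I \<longrightarrow>
              (\<exists>L. principal_operator_ideal L \<and> J \<subseteq> L \<and> L \<subseteq> I)) \<longrightarrow>
           (\<exists>\<C>. chain\<^sub>\<subseteq> \<C> \<and> (\<forall>J\<in>\<C>. principal_operator_ideal J) \<and> I = \<Union>\<C>))"
proof (intro conjI allI impI)
  fix I :: "('h \<Rightarrow> 'h) set"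
  assume I: "operator_ideal I"
  \<comment> \<open>Taking only ideals inside \<open>I\<close> keeps the union of the chain from
    exceeding \<open>I\<close>.\<close>
  have "\<exists>\<C>\<subseteq>{J. countably_generated_operator_ideal J \<and> J \<subseteq> I}. chain\<^sub>\<subseteq> \<C> \<and> I = \<Union>\<C>"
  proof (rule chain_union_if_countably_directed[OF assms(1) operator_ideal_lepoll_reals[OF assms(2) I]])
    fix D T
    assume "countable D" "D \<subseteq> {J. countably_generated_operator_ideal J \<and> J \<subseteq> I}" "T \<in> I"
    then show "\<exists>L\<in>{J. countably_generated_operator_ideal J \<and> J \<subseteq> I}. T \<in> L \<and> \<Union>D \<subseteq> L"
      using countably_generated_operator_ideals_directed[OF I, of D T] by blast
  qed blast
  then show "\<exists>\<C>. chain\<^sub>\<subseteq> \<C> \<and> (\<forall>J\<in>\<C>. countably_generated_operator_ideal J) \<and> I = \<Union>\<C>"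
    by blast
next
  fix I :: "('h \<Rightarrow> 'h) set"
  assume I: "operator_ideal I"
    and principal: "\<forall>J. countably_generated_operator_ideal J \<and> J \<subseteq> I \<longrightarrow>
      (\<exists>L. principal_operator_ideal L \<and> J \<subseteq> L \<and> L \<subseteq> I)"
  have "\<exists>\<C>\<subseteq>{J. principal_operator_ideal J \<and> J \<subseteq> I}. chain\<^sub>\<subseteq> \<C> \<and> I = \<Union>\<C>"
  proof (rule chain_union_if_countably_directed[OF assms(1) operator_ideal_lepoll_reals[OF assms(2) I]])
    fix D T
    assume D: "countable D" "D \<subseteq> {J. principal_operator_ideal J \<and> J \<subseteq> I}" and T: "T \<in> I"
    have "\<And>J. J \<in> D \<Longrightarrow> countably_generated_operator_ideal J \<and> J \<subseteq> I"
      using D(2) principal_imp_countably_generated by blast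
    \<comment> \<open>The hypothesis \<open>principal\<close> enlarges one countably generated ideal
      at a time, so \<open>T\<close> and all of \<open>D\<close> are first gathered into a single
      such \<open>J\<close> inside \<open>I\<close>.\<close>
    then obtain J where J: "countably_generated_operator_ideal J" "J \<subseteq> I" "T \<in> J" "\<Union>D \<subseteq> J"
      using countably_generated_operator_ideals_directed[OF I D(1) T] by blast
    then obtain L where "principal_operator_ideal L" "J \<subseteq> L" "L \<subseteq> I"
      using principal by blast
    then show "\<exists>L\<in>{J. principal_operator_ideal J \<and> J \<subseteq> I}. T \<in> L \<and> \<Union>D \<subseteq> L"
      using J by (intro bexI[of _ L]) auto
  qed blast
  then show "\<exists>\<C>. chain\<^sub>\<subseteq> \<C> \<and> (\<forall>J\<in>\<C>. principal_operator_ideal J) \<and> I = \<Union>\<C>"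
    by blast
qed

end
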